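(* Let $X$ and $Z$ be real reflexive Banach spaces, $U\subset Z$ a nonempty control set, $K:X^*\to X$, $N:X\to X^*$, $H:U\to X$ operators, and $\phi:Z\times X\to\mathbb{R}$ a cost functional. Consider the system $$x=KNx+Hu,\qquad u\in U,$$ with solution operator $T:U\to X$, $Tu=x$. Suppose that: (a) at least one of the following two sets of conditions holds: Set A: (A1) $K$ is linear and compact and there is a constant $d>0$ with $\langle Kx,x\rangle\ge d\|Kx\|^2$ for all $x\in X^*$; (A2) $N$ is continuous, bounded and negatively monotone; (A3) $H$ is completely continuous. Set B: (B1) $K$ is linear and belongs to the class $\mathcal{M}$; (B2) $N$ is Lipschitz, $\mu(-N)>0$ and $(\mu(K)+\mu(-N))\,(\|N\|^{*})^{-2}>0$; (B3) $H$ is completely continuous. (b) for each fixed $x$, the map $u\mapsto\phi(u,x)$ is convex and continuous, and the map $x\mapsto\phi(u,x)$ is continuous, uniformly for all $u\in U$; (c) $U$ is weakly compact. Then the system has an optimal pair $(u^*,x^* )$, i.e. there is $u^*\in U$ with $x^*=Tu^*$ and $\phi(u^*,x^* )=\inf_{u\in U}\phi(u,Tu)$.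
   Context: Standing assumption: for each control $u\in U$ the equation $x=KNx+Hu$ has a unique solution $x\in X$, and $T:U\to X$ denotes the operator $u\mapsto x$. $\langle\cdot,\cdot\rangle$ is the duality pairing. "Bounded" (for nonlinear maps) means mapping bounded sets to bounded sets. $N$ is negatively monotone if $\langle Nx-Ny,x-y\rangle\le 0$ for all $x,y$. $H$ is completely continuous if $u_n\rightharpoonup u$ weakly (with $u_n,u\in U$) implies $Hu_n\to Hu$ in norm. Class $\mathcal{M}$: for a real Hilbert space $E$, $\mathcal{M}$ is the set of operators $P:E\to E$ such that $\langle Px_1-Px_2,x_1-x_2\rangle\ge\aleph_1\|x_1-x_2\|^2$ for all $x_1,x_2\in E$, with some positive constant $\aleph_1$. For an operator $P:E\to E$, $$\mu(P)=\inf_{x_1\ne x_2}\frac{\langle Px_1-Px_2,x_1-x_2\rangle}{\|x_1-x_2\|^2}.$$ When Set B is used, $X$ is a real Hilbert space identified with $X^*$. $\|N\|^{*}$ denotes the least Lipschitz constant of $N$. Continuity of $x\mapsto\phi(u,x)$ uniformly for $u\in U$ means: $x_n\to x$ in $X$ implies $\sup_{u\in U}|\phi(u,x_n)-\phi(u,x)|\to 0$. *)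

theory Defs
  imports "HOL-Analysis.Analysis"
begin

text \<open>The dual of a real normed space \<open>'a\<close> is \<^typ>\<open>'a::real_normed_vector \<Rightarrow>\<^sub>L real\<close> with the operator norm;
  the duality pairing of \<open>f\<close> in the dual with \<open>x\<close> is \<^term>\<open>blinfun_apply f x\<close>.\<close>

text \<open>Reflexivity: the canonical embedding into the bidual, \<open>x \<mapsto> (f \<mapsto> f x)\<close>, is onto.\<close>

definition reflexive_space :: "'a::real_normed_vector itself \<Rightarrow> bool" where
  "reflexive_space _ \<longleftrightarrow>
     (\<forall>F :: ('a \<Rightarrow>\<^sub>L real) \<Rightarrow>\<^sub>L real. \<exists>x :: 'a. \<forall>f. blinfun_apply F f = blinfun_apply f x)"

text \<open>The coarsest topology making every element of the dual continuous, i.e. the pullback of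
  the product topology along \<open>x \<mapsto> (f \<mapsto> f x)\<close>.\<close>

definition weak_topology :: "'a::real_normed_vector topology" where
  "weak_topology = pullback_topology UNIV (\<lambda>x (f :: 'a \<Rightarrow>\<^sub>L real). blinfun_apply f x) euclidean"

lemma limitin_weak_topology_iff:
  "limitin weak_topology u l F \<longleftrightarrow>
     (\<forall>f :: 'a::real_normed_vector \<Rightarrow>\<^sub>L real. ((\<lambda>n. blinfun_apply f (u n)) \<longlongrightarrow> blinfun_apply f l) F)"
proof -
  let ?g = "\<lambda>x (f :: 'a \<Rightarrow>\<^sub>L real). blinfun_apply f x"
  have "limitin weak_topology u l F \<longleftrightarrow> limitin euclidean (\<lambda>n. ?g (u n)) (?g l) F"
    unfolding weak_topology_def limitin_def
    by (auto simp: topspace_pullback_topology openin_pullback_topology)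
  also have "\<dots> \<longleftrightarrow> limitin (product_topology (\<lambda>_. euclidean) UNIV) (\<lambda>n. ?g (u n)) (?g l) F"
    by (simp add: euclidean_product_topology)
  finally show ?thesis
    by (simp add: limitin_componentwise)
qed

definition completely_continuous_on ::
    "'z::real_normed_vector set \<Rightarrow> ('z \<Rightarrow> 'x::real_normed_vector) \<Rightarrow> bool" where
  "completely_continuous_on U H \<longleftrightarrow>
     (\<forall>u l. (\<forall>n :: nat. u n \<in> U) \<and> l \<in> U \<and> limitin weak_topology u l sequentially
        \<longrightarrow> (\<lambda>n. H (u n)) \<longlonglongrightarrow> H l)"

definition compact_operator :: "('a::real_normed_vector \<Rightarrow> 'b::real_normed_vector) \<Rightarrow> bool" where
  "compact_operator K \<longleftrightarrow> (\<forall>S. bounded S \<longrightarrow> compact (closure (K ` S)))"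

definition bounded_map :: "('a::real_normed_vector \<Rightarrow> 'b::real_normed_vector) \<Rightarrow> bool" where
  "bounded_map N \<longleftrightarrow> (\<forall>S. bounded S \<longrightarrow> bounded (N ` S))"

definition negatively_monotone :: "('x::real_normed_vector \<Rightarrow> ('x \<Rightarrow>\<^sub>L real)) \<Rightarrow> bool" where
  "negatively_monotone N \<longleftrightarrow> (\<forall>x y. blinfun_apply (N x - N y) (x - y) \<le> 0)"

definition solution_operator ::
    "(('x::real_normed_vector \<Rightarrow>\<^sub>L real) \<Rightarrow> 'x) \<Rightarrow> ('x \<Rightarrow> ('x \<Rightarrow>\<^sub>L real)) \<Rightarrow> ('z \<Rightarrow> 'x) \<Rightarrow> 'z \<Rightarrow> 'x" where
  "solution_operator K N H u = (THE x. x = K (N x) + H u)"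

text \<open>That a given Banach space is a Hilbert space is a property of its norm, not a second type
  class constraint: \<open>ip\<close> is an inner product inducing the norm. The assumptions are those of class
  \<^class>\<open>real_inner\<close>; positivity is contained in the last one.\<close>

definition hilbert_inner :: "('x::real_normed_vector \<Rightarrow> 'x \<Rightarrow> real) \<Rightarrow> bool" where
  "hilbert_inner ip \<longleftrightarrow>
     (\<forall>x y. ip x y = ip y x) \<and>
     (\<forall>x y z. ip (x + y) z = ip x z + ip y z) \<and>
     (\<forall>r x y. ip (r *\<^sub>R x) y = r * ip x y) \<and>
     (\<forall>x. ip x x = (norm x)\<^sup>2)"

lemma hilbert_inner_inner: "hilbert_inner (inner :: 'x::real_inner \<Rightarrow> 'x \<Rightarrow> real)"
  by (simp add: hilbert_inner_def inner_commute inner_add_right power2_norm_eq_inner)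

text \<open>The Riesz identification of a Hilbert space with its dual.\<close>

definition riesz :: "('x::real_normed_vector \<Rightarrow> 'x \<Rightarrow> real) \<Rightarrow> 'x \<Rightarrow> ('x \<Rightarrow>\<^sub>L real)" where
  "riesz ip y = Blinfun (ip y)"

lemma riesz_apply:
  assumes "hilbert_inner ip"
  shows "blinfun_apply (riesz ip y) x = ip y x"
proof -
  have comm: "ip a b = ip b a" and addl: "ip (a + b) c = ip a c + ip b c"
    and scl: "ip (r *\<^sub>R a) b = r * ip a b" and sq: "ip a a = (norm a)\<^sup>2" for a b c r
    using assms unfolding hilbert_inner_def by blast+
  have addr: "ip a (b + c) = ip a b + ip a c" for a b c
    by (metis comm addl)
  have scr: "ip a (r *\<^sub>R b) = r * ip a b" for a b r
    by (metis comm scl)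
  have cs: "\<bar>ip a b\<bar> \<le> norm b * norm a" for a b
  proof (cases "b = 0")
    case True
    then show ?thesis using scr[of a 0 b] by simp
  next
    case False
    define t where "t = ip a b / (norm b)\<^sup>2"
    have nb: "(norm b)\<^sup>2 > 0" using False by simp
    have "0 \<le> ip (a + (- t) *\<^sub>R b) (a + (- t) *\<^sub>R b)" by (simp only: sq zero_le_power2)
    also have "\<dots> = (norm a)\<^sup>2 - 2 * t * ip a b + t\<^sup>2 * (norm b)\<^sup>2"
      unfolding addl addr scl scr comm[of b a] sq[of a] sq[of b]
      by (simp add: power2_eq_square algebra_simps)
    also have "\<dots> = (norm a)\<^sup>2 - (ip a b)\<^sup>2 / (norm b)\<^sup>2"
      using nb by (simp add: t_def power2_eq_square field_simps)
    finally have "(ip a b)\<^sup>2 \<le> (norm b * norm a)\<^sup>2"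
      using nb by (simp add: field_simps power_mult_distrib)
    then show ?thesis by (metis abs_le_square_iff abs_mult abs_norm_cancel)
  qed
  have "bounded_linear (ip y)"
    by (rule bounded_linear_intro[where K = "norm y"])
      (use addr scr cs in auto)
  then show ?thesis unfolding riesz_def by (simp add: bounded_linear_Blinfun_apply)
qed

text \<open>In the following, \<open>ip\<close> is the inner product of a Hilbert space and \<open>P\<close> an operator on it.\<close>

definition class_M :: "('x::real_normed_vector \<Rightarrow> 'x \<Rightarrow> real) \<Rightarrow> ('x \<Rightarrow> 'x) \<Rightarrow> bool" where
  "class_M ip P \<longleftrightarrow>
     (\<exists>c > 0. \<forall>x1 x2. ip (P x1 - P x2) (x1 - x2) \<ge> c * (norm (x1 - x2))\<^sup>2)"

text \<open>An extended real, so that the infimum is meaningful even if it is \<open>-\<infinity>\<close> or if the index set is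
  empty.\<close>

definition mu :: "('x::real_normed_vector \<Rightarrow> 'x \<Rightarrow> real) \<Rightarrow> ('x \<Rightarrow> 'x) \<Rightarrow> ereal" where
  "mu ip P = (INF (x1, x2) \<in> {(x1, x2). x1 \<noteq> x2}.
     ereal (ip (P x1 - P x2) (x1 - x2) / (norm (x1 - x2))\<^sup>2))"

text \<open>Used only for Lipschitz maps, for which the set is nonempty and the infimum is attained.\<close>

definition lipschitz_const :: "('a::metric_space \<Rightarrow> 'b::metric_space) \<Rightarrow> real" where
  "lipschitz_const N = Inf {L. L-lipschitz_on UNIV N}"

definition conditions_A ::
    "'z::real_normed_vector set \<Rightarrow> (('x::real_normed_vector \<Rightarrow>\<^sub>L real) \<Rightarrow> 'x) \<Rightarrow>
     ('x \<Rightarrow> ('x \<Rightarrow>\<^sub>L real)) \<Rightarrow> ('z \<Rightarrow> 'x) \<Rightarrow> bool" where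
  "conditions_A U K N H \<longleftrightarrow>
     linear K \<and> compact_operator K \<and>
     (\<exists>d > 0. \<forall>f. blinfun_apply f (K f) \<ge> d * (norm (K f))\<^sup>2) \<and>
     continuous_on UNIV N \<and> bounded_map N \<and> negatively_monotone N \<and>
     completely_continuous_on U H"

text \<open>Identifying the Hilbert space with its dual turns \<open>K\<close> into \<open>K \<circ> riesz ip\<close> and \<open>N\<close> into
  \<open>inv (riesz ip) \<circ> N\<close>; on a Banach space \<open>riesz ip\<close> is a bijection by the Riesz representation
  theorem.\<close>

definition conditions_B ::
    "'z::real_normed_vector set \<Rightarrow> (('x::real_normed_vector \<Rightarrow>\<^sub>L real) \<Rightarrow> 'x) \<Rightarrow>
     ('x \<Rightarrow> ('x \<Rightarrow>\<^sub>L real)) \<Rightarrow> ('z \<Rightarrow> 'x) \<Rightarrow> bool" where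
  "conditions_B U K N H \<longleftrightarrow>
     (\<exists>ip. hilbert_inner ip \<and>
       (let K' = K \<circ> riesz ip; N' = inv (riesz ip) \<circ> N in
          linear K \<and> class_M ip K' \<and>
          (\<exists>L. L-lipschitz_on UNIV N') \<and>
          mu ip (\<lambda>x. - N' x) > 0 \<and>
          (mu ip K' + mu ip (\<lambda>x. - N' x)) * inverse ((ereal (lipschitz_const N'))\<^sup>2) > 0 \<and>
          completely_continuous_on U H))"

end

theory Submission
  imports Defs
begin

text \<open>The proof is the direct method of the calculus of variations: a minimizing sequence
  \<open>v n\<close> in \<open>U\<close> is passed through three facts.

  (1) It has a subsequence converging weakly to some \<open>us \<in> U\<close>. Weak compactness of \<open>U\<close> is a
  statement about covers, so this is the Eberlein-Smulian theorem
  (\<open>weakly_compact_imp_weakly_seq_compact\<close>).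

  (2) The solution operator \<open>T\<close> is completely continuous, so \<open>T (v n)\<close> converges to \<open>T us\<close> in norm
  along the subsequence. Because \<open>H\<close> is completely continuous, it suffices that solutions of
  \<open>x = K (N x) + h\<close> depend continuously on \<open>h\<close>. Write \<open>z\<close>, \<open>w\<close> and \<open>\<delta>\<close> for the differences of \<open>x\<close>,
  \<open>N x\<close> and \<open>h\<close> for two solutions, so that \<open>z = K w + \<delta>\<close> by linearity of \<open>K\<close>. Monotonicity of \<open>-N\<close>
  bounds \<open>\<langle>w, z\<rangle>\<close> from above by a nonpositive number and the hypothesis on \<open>K\<close> bounds \<open>\<langle>w, K w\<rangle>\<close>
  from below; together they control \<open>z\<close> by \<open>\<langle>w, \<delta>\<rangle>\<close>. In the Hilbert space case, strong monotonicity of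
  both operators makes this a one-line estimate by completing the square. In the Banach space case
  the term \<open>\<langle>w, \<delta>\<rangle>\<close> is harmless only once \<open>w\<close> is known to be bounded, and \<open>N\<close> may grow arbitrarily
  fast at the unknown solution. The bound comes from testing monotonicity not against the limit
  solution \<open>x0\<close> alone but against all \<open>x0 + v\<close> with \<open>norm v \<le> 1\<close>, as in the proof that monotone
  operators are locally bounded (\<open>monotone_perturbation_estimate\<close>).

  (3) The cost is lower semicontinuous along the subsequence: the uniformity in \<open>u\<close> allows
  \<open>T (v n)\<close> to be replaced by \<open>T us\<close>, and \<open>u \<mapsto> \<phi> (u, T us)\<close> is minorized by an affine continuous
  functional which is exact at \<open>us\<close> (\<open>cost_weakly_lower_semicontinuous\<close>).

  The functional analysis behind (1) and (3) is one statement, the existence of subgradients of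
  continuous convex functions (\<open>convex_subgradient\<close>). Applied to the norm it gives norming
  functionals, and applied to the distance from a closed convex set it gives Mazur's theorem that
  such a set is weakly closed.\<close>

section \<open>The Hahn-Banach theorem for sublinear functionals\<close>

definition sublinear :: "('a::real_vector \<Rightarrow> real) \<Rightarrow> bool" where
  "sublinear p \<longleftrightarrow>
     (\<forall>x y. p (x + y) \<le> p x + p y) \<and> (\<forall>t x. t > 0 \<longrightarrow> p (t *\<^sub>R x) = t * p x)"

lemma sublinear_0:
  assumes "sublinear p"
  shows "p 0 = 0"
proof -
  have "p (2 *\<^sub>R 0) = 2 * p 0"
    using assms unfolding sublinear_def by (metis zero_less_numeral)
  then show ?thesis by simp
qed

lemma sublinear_lower:
  assumes "sublinear p"
  shows "- p (- x) \<le> p x"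
proof -
  have "p (x + - x) \<le> p x + p (- x)"
    using assms unfolding sublinear_def by blast
  then show ?thesis using sublinear_0[OF assms] by simp
qed

lemma sublinear_INF_chain:
  fixes C :: "('a::real_vector \<Rightarrow> real) set"
  assumes sub: "\<And>q. q \<in> C \<Longrightarrow> sublinear q" and "C \<noteq> {}"
    and chain: "\<And>q r. q \<in> C \<Longrightarrow> r \<in> C \<Longrightarrow> q \<le> r \<or> r \<le> q"
    and lower: "\<And>x. bdd_below ((\<lambda>q. q x) ` C)"
  shows "sublinear (\<lambda>x. INF q\<in>C. q x)"
  unfolding sublinear_def
proof (intro conjI allI impI)
  fix x y
  have "(INF q\<in>C. q (x + y)) \<le> q x + r y" if q: "q \<in> C" and r: "r \<in> C" for q r
  proof -
    \<comment> \<open>The smaller of the two functionals serves for both points.\<close>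
    obtain s where s: "s \<in> C" "s \<le> q" "s \<le> r"
      using chain[OF q r] q r by auto
    have "(INF q\<in>C. q (x + y)) \<le> s (x + y)"
      by (rule cINF_lower[OF lower s(1)])
    also have "\<dots> \<le> s x + s y" using sub[OF s(1)] by (simp add: sublinear_def)
    also have "\<dots> \<le> q x + r y" using s(2,3) by (intro add_mono) (auto simp: le_fun_def)
    finally show ?thesis .
  qed
  then have "(INF q\<in>C. q (x + y)) - r y \<le> (INF q\<in>C. q x)" if "r \<in> C" for r
    using that by (intro cINF_greatest[OF \<open>C \<noteq> {}\<close>]) (auto simp: algebra_simps)
  then have "(INF q\<in>C. q (x + y)) - (INF q\<in>C. q x) \<le> (INF r\<in>C. r y)"
    by (intro cINF_greatest[OF \<open>C \<noteq> {}\<close>]) (auto simp: algebra_simps)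
  then show "(INF q\<in>C. q (x + y)) \<le> (INF q\<in>C. q x) + (INF q\<in>C. q y)" by simp
next
  fix t :: real and x :: 'a
  assume t: "t > 0"
  have le: "t * (INF q\<in>C. q x) \<le> (INF q\<in>C. q (t *\<^sub>R x))" if "t > 0" for t x
  proof (rule cINF_greatest[OF \<open>C \<noteq> {}\<close>])
    fix q assume q: "q \<in> C"
    have "(INF q\<in>C. q x) \<le> q x" by (rule cINF_lower[OF lower q])
    then show "t * (INF q\<in>C. q x) \<le> q (t *\<^sub>R x)"
      using sub[OF q] that by (simp add: sublinear_def)
  qed
  have "inverse t * (INF q\<in>C. q (t *\<^sub>R x)) \<le> (INF q\<in>C. q x)"
    using le[of "inverse t" "t *\<^sub>R x"] t by simp
  then show "(INF q\<in>C. q (t *\<^sub>R x)) = t * (INF q\<in>C. q x)"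
    using le[OF t, of x] t by (simp add: field_simps)
qed

text \<open>The sublinear functional \<open>q\<close> lies below \<open>p\<close> and has \<open>q (- a) \<le> - p a\<close>. If \<open>p\<close> is minimal among
  sublinear functionals, then \<open>q = p\<close> for every \<open>a\<close>, which makes \<open>p\<close> odd; an odd sublinear
  functional is linear.\<close>

lemma sublinear_slide:
  fixes p :: "'a::real_vector \<Rightarrow> real" and a :: 'a
  assumes p: "sublinear p"
  defines "q \<equiv> \<lambda>x. INF t\<in>{0..}. p (x + t *\<^sub>R a) - t * p a"
  shows "sublinear q" and "q \<le> p" and "q (- a) \<le> - p a"
proof -
  have add: "p (x + y) \<le> p x + p y" for x y using p by (simp add: sublinear_def)
  have scale0: "p (t *\<^sub>R x) = t * p x" if "t \<ge> 0" for t x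
    using p sublinear_0[OF p] that by (cases "t = 0") (auto simp: sublinear_def)
  have bdd: "bdd_below ((\<lambda>t. p (x + t *\<^sub>R a) - t * p a) ` {0..})" for x
  proof (rule bdd_belowI2[of _ "- p (- x)"])
    fix t :: real assume "t \<in> {0..}"
    then have "t * p a = p ((x + t *\<^sub>R a) + - x)" using scale0[of t a] by simp
    also have "\<dots> \<le> p (x + t *\<^sub>R a) + p (- x)" by (rule add)
    finally show "- p (- x) \<le> p (x + t *\<^sub>R a) - t * p a" by simp
  qed
  have q_le: "q x \<le> p (x + t *\<^sub>R a) - t * p a" if "t \<ge> 0" for x t
    unfolding q_def using that by (intro cINF_lower[OF bdd]) auto
  have q_ge: "c \<le> q x" if "\<And>t. t \<ge> 0 \<Longrightarrow> c \<le> p (x + t *\<^sub>R a) - t * p a" for x c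
    unfolding q_def by (rule cINF_greatest) (use that in auto)
  show "q \<le> p" using q_le[of 0] by (simp add: le_fun_def)
  show "q (- a) \<le> - p a" using q_le[of 1 "- a"] sublinear_0[OF p] by simp
  have "q (x + y) \<le> q x + q y" for x y
  proof -
    have "q (x + y) \<le> (p (x + t *\<^sub>R a) - t * p a) + (p (y + s *\<^sub>R a) - s * p a)"
      if "t \<ge> 0" "s \<ge> 0" for t s
      using q_le[of "t + s" "x + y"] add[of "x + t *\<^sub>R a" "y + s *\<^sub>R a"] that
      by (simp add: algebra_simps)
    then have "q (x + y) - (p (y + s *\<^sub>R a) - s * p a) \<le> q x" if "s \<ge> 0" for s
      using that by (intro q_ge) (simp add: algebra_simps)
    then have "q (x + y) - q x \<le> q y" by (intro q_ge) (simp add: algebra_simps)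
    then show ?thesis by simp
  qed
  moreover have "q (t *\<^sub>R x) = t * q x" if t: "t > 0" for t x
  proof -
    have le: "t * q x \<le> q (t *\<^sub>R x)" if t: "t > 0" for t x
    proof (rule q_ge)
      fix s :: real assume s: "s \<ge> 0"
      have "t * q x \<le> t * (p (x + (s / t) *\<^sub>R a) - (s / t) * p a)"
        using q_le[of "s / t" x] s t by (intro mult_left_mono) auto
      also have "\<dots> = p (t *\<^sub>R (x + (s / t) *\<^sub>R a)) - s * p a"
        using scale0[of t] t by (simp add: right_diff_distrib)
      also have "\<dots> = p (t *\<^sub>R x + s *\<^sub>R a) - s * p a"
        using t by (simp add: scaleR_add_right)
      finally show "t * q x \<le> p (t *\<^sub>R x + s *\<^sub>R a) - s * p a" .
    qed
    have "inverse t * q (t *\<^sub>R x) \<le> q x" using le[of "inverse t" "t *\<^sub>R x"] t by simp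
    then show ?thesis using le[OF t, of x] t by (simp add: field_simps)
  qed
  ultimately show "sublinear q" by (simp add: sublinear_def)
qed

text \<open>Zorn's lemma is applied to the sublinear functionals below \<open>p\<close>, ordered downwards, rather than to
  partially defined linear functionals: every chain has its pointwise infimum as a lower bound, and
  by \<open>sublinear_slide\<close> a minimal element is linear.\<close>

theorem hahn_banach_sublinear:
  fixes p :: "'a::real_vector \<Rightarrow> real"
  assumes p: "sublinear p"
  obtains f where "linear f" and "f \<le> p"
proof -
  define A where "A = {q. sublinear q \<and> q \<le> p}"
  have ord: "partial_order_on A (relation_of (\<lambda>q r. r \<le> q) A)"
    by (rule partial_order_on_relation_ofI) auto
  have "\<exists>m\<in>A. \<forall>q\<in>A. q \<le> m \<longrightarrow> q = m"
  proof (rule predicate_Zorn[OF ord])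
    fix C assume "C \<in> Chains (relation_of (\<lambda>q r. r \<le> q) A)"
    then have CA: "C \<subseteq> A" and chain: "\<And>q r. q \<in> C \<Longrightarrow> r \<in> C \<Longrightarrow> q \<le> r \<or> r \<le> q"
      by (auto simp: Chains_def relation_of_def)
    show "\<exists>l\<in>A. \<forall>q\<in>C. l \<le> q"
    proof (cases "C = {}")
      case True
      then show ?thesis using p by (auto simp: A_def)
    next
      case False
      have bdd: "bdd_below ((\<lambda>q. q x) ` C)" for x
      proof (rule bdd_belowI2[of _ "- p (- x)"])
        \<comment> \<open>All members of the chain share the lower bound that sublinearity gives at \<open>x\<close>.\<close>
        fix q assume "q \<in> C"
        then have "sublinear q" and "q (- x) \<le> p (- x)" using CA by (auto simp: A_def le_fun_def)
        then show "- p (- x) \<le> q x" using sublinear_lower[of q x] by linarith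
      qed
      define l where "l = (\<lambda>x. INF q\<in>C. q x)"
      have "sublinear l" unfolding l_def
        by (rule sublinear_INF_chain[OF _ False chain bdd]) (use CA in \<open>auto simp: A_def\<close>)
      moreover have low: "l \<le> q" if "q \<in> C" for q
        unfolding l_def le_fun_def by (intro allI cINF_lower[OF bdd that])
      moreover have "l \<le> p"
      proof -
        obtain q where "q \<in> C" using False by blast
        then show ?thesis using low[of q] CA by (auto simp: A_def)
      qed
      ultimately show ?thesis by (auto simp: A_def)
    qed
  qed
  then obtain m where m: "sublinear m" "m \<le> p" and min: "\<And>q. sublinear q \<Longrightarrow> q \<le> p \<Longrightarrow> q \<le> m \<Longrightarrow> q = m"
    by (auto simp: A_def)
  have neg_le: "m (- a) \<le> - m a" for a
  proof -
    note slide = sublinear_slide[OF m(1), of a]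
    note slide_eq = min[OF slide(1) order_trans[OF slide(2) m(2)] slide(2)]
    show ?thesis
      by (rule ord_eq_le_trans[OF fun_cong[OF slide_eq, symmetric] slide(3)])
  qed
  have neg: "m (- a) = - m a" for a
    using neg_le[of a] sublinear_lower[OF m(1), of a] by simp
  have "linear m"
  proof (rule linearI)
    fix x y
    have "m (x + y) \<le> m x + m y" "m (- x + - y) \<le> m (- x) + m (- y)"
      using m(1) unfolding sublinear_def by blast+
    then show "m (x + y) = m x + m y" using neg[of "x + y"] neg[of x] neg[of y] by simp
  next
    fix r :: real and x
    consider "r > 0" | "r = 0" | "r < 0" by linarith
    then show "m (r *\<^sub>R x) = r *\<^sub>R m x"
    proof cases
      case 1
      then show ?thesis using m(1) by (simp add: sublinear_def)
    next
      case 2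
      then show ?thesis using sublinear_0[OF m(1)] by simp
    next
      case 3
      then have "m ((- r) *\<^sub>R x) = (- r) * m x"
        using m(1)[unfolded sublinear_def, THEN conjunct2, rule_format, of "- r" x] by linarith
      then show ?thesis using neg[of "r *\<^sub>R x"] by simp
    qed
  qed
  then show ?thesis using that m(2) by blast
qed

section \<open>Subgradients of continuous convex functions\<close>

text \<open>By convexity the difference quotients of \<open>g\<close> at \<open>l\<close> are bounded below in every direction, and
  their infimum over the step is the one-sided directional derivative.\<close>

lemma sublinear_directional_derivative:
  fixes g :: "'a::real_vector \<Rightarrow> real" and l :: 'a
  assumes g: "convex_on UNIV g"
  defines "p \<equiv> \<lambda>h. INF t\<in>{0<..}. (g (l + t *\<^sub>R h) - g l) / t"
  shows "sublinear p" and "p h \<le> g (l + h) - g l"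
proof -
  have conv: "g (s *\<^sub>R x + t *\<^sub>R y) \<le> s * g x + t * g y" if "s \<ge> 0" "t \<ge> 0" "s + t = 1" for s t x y
    using g that by (auto simp: convex_on_def)
  have bdd: "bdd_below ((\<lambda>t. (g (l + t *\<^sub>R h) - g l) / t) ` {0<..})" for h
  proof (rule bdd_belowI2[of _ "- (g (l - h) - g l)"])
    fix t :: real assume "t \<in> {0<..}"
    then have t: "t > 0" by simp
    \<comment> \<open>The base point divides the segment from \<open>l + t *\<^sub>R h\<close> to \<open>l - h\<close> in the ratio \<open>t : 1\<close>.\<close>
    define \<sigma> where "\<sigma> = 1 / (1 + t)"
    define \<tau> where "\<tau> = t / (1 + t)"
    have st: "\<sigma> \<ge> 0" "\<tau> \<ge> 0" "\<sigma> + \<tau> = 1" "\<sigma> * t = \<tau>"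
      using t by (auto simp: \<sigma>_def \<tau>_def add_divide_distrib[symmetric])
    have "\<sigma> *\<^sub>R (l + t *\<^sub>R h) + \<tau> *\<^sub>R (l - h) = (\<sigma> + \<tau>) *\<^sub>R l + (\<sigma> * t - \<tau>) *\<^sub>R h"
      by (simp add: algebra_simps)
    also have "\<dots> = l" using st by simp
    finally have "g l \<le> \<sigma> * g (l + t *\<^sub>R h) + \<tau> * g (l - h)"
      using conv[of \<sigma> \<tau> "l + t *\<^sub>R h" "l - h"] st by simp
    then have "(1 + t) * g l \<le> (1 + t) * (\<sigma> * g (l + t *\<^sub>R h) + \<tau> * g (l - h))"
      using t by simp
    also have "\<dots> = ((1 + t) * \<sigma>) * g (l + t *\<^sub>R h) + ((1 + t) * \<tau>) * g (l - h)"
      by (simp only: distrib_left mult.assoc)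
    also have "\<dots> = g (l + t *\<^sub>R h) + t * g (l - h)"
      using t by (simp add: \<sigma>_def \<tau>_def)
    finally have "- (t * (g (l - h) - g l)) \<le> g (l + t *\<^sub>R h) - g l"
      by (simp add: algebra_simps)
    then show "- (g (l - h) - g l) \<le> (g (l + t *\<^sub>R h) - g l) / t"
      using t by (simp add: field_simps)
  qed
  have p_le: "p h \<le> (g (l + t *\<^sub>R h) - g l) / t" if "t > 0" for h t
    unfolding p_def using that by (intro cINF_lower[OF bdd]) auto
  have p_ge: "c \<le> p h" if "\<And>t. t > 0 \<Longrightarrow> c \<le> (g (l + t *\<^sub>R h) - g l) / t" for c h
    unfolding p_def by (rule cINF_greatest) (use that in auto)
  show "p h \<le> g (l + h) - g l" using p_le[of 1] by simp
  have "p (h + k) \<le> p h + p k" for h k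
  proof -
    have "p (h + k) \<le> (g (l + t *\<^sub>R h) - g l) / t + (g (l + s *\<^sub>R k) - g l) / s"
      if t: "t > 0" and s: "s > 0" for t s
    proof -
      \<comment> \<open>The step for which \<open>l + r *\<^sub>R (h + k)\<close> lies on the segment from \<open>l + t *\<^sub>R h\<close> to
        \<open>l + s *\<^sub>R k\<close>.\<close>
      define r where "r = t * s / (t + s)"
      have r: "r > 0" using t s by (simp add: r_def)
      define \<sigma> where "\<sigma> = s / (t + s)"
      define \<tau> where "\<tau> = t / (t + s)"
      have st: "\<sigma> \<ge> 0" "\<tau> \<ge> 0" "\<sigma> + \<tau> = 1" "\<sigma> * t = r" "\<tau> * s = r"
        using t s by (auto simp: \<sigma>_def \<tau>_def r_def add_divide_distrib[symmetric] add.commute mult.commute)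
      have "\<sigma> *\<^sub>R (l + t *\<^sub>R h) + \<tau> *\<^sub>R (l + s *\<^sub>R k) = (\<sigma> + \<tau>) *\<^sub>R l + (\<sigma> * t) *\<^sub>R h + (\<tau> * s) *\<^sub>R k"
        by (simp only: scaleR_add_left scaleR_add_right scaleR_scaleR add_ac)
      also have "\<dots> = l + r *\<^sub>R (h + k)" using st by (simp add: scaleR_add_right)
      finally have "g (l + r *\<^sub>R (h + k)) \<le> \<sigma> * g (l + t *\<^sub>R h) + \<tau> * g (l + s *\<^sub>R k)"
        using conv[of \<sigma> \<tau> "l + t *\<^sub>R h" "l + s *\<^sub>R k"] st by simp
      moreover have "g l = \<sigma> * g l + \<tau> * g l" using st by (simp add: distrib_right[symmetric])
      ultimately have "g (l + r *\<^sub>R (h + k)) - g l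
          \<le> \<sigma> * (g (l + t *\<^sub>R h) - g l) + \<tau> * (g (l + s *\<^sub>R k) - g l)"
        by (simp add: right_diff_distrib)
      then have "(g (l + r *\<^sub>R (h + k)) - g l) / r
          \<le> (\<sigma> * (g (l + t *\<^sub>R h) - g l) + \<tau> * (g (l + s *\<^sub>R k) - g l)) / r"
        using r by (simp add: divide_right_mono)
      also have "\<dots> = (\<sigma> / r) * (g (l + t *\<^sub>R h) - g l) + (\<tau> / r) * (g (l + s *\<^sub>R k) - g l)"
        by (simp add: add_divide_distrib)
      also have "\<sigma> / r = 1 / t" using st(4) t r by (simp add: field_simps)
      also have "\<tau> / r = 1 / s" using st(5) s r by (simp add: field_simps)
      finally show ?thesis using p_le[OF r, of "h + k"] by simp
    qed
    then have "p (h + k) - (g (l + s *\<^sub>R k) - g l) / s \<le> p h" if "s > 0" for s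
      using that by (intro p_ge) (simp add: algebra_simps)
    then have "p (h + k) - p h \<le> p k" by (intro p_ge) (simp add: algebra_simps)
    then show ?thesis by simp
  qed
  moreover have "p (t *\<^sub>R h) = t * p h" if t: "t > 0" for t h
  proof -
    have le: "t * p h \<le> p (t *\<^sub>R h)" if t: "t > 0" for t h
    proof (rule p_ge)
      fix s :: real assume s: "s > 0"
      have "t * p h \<le> t * ((g (l + (s * t) *\<^sub>R h) - g l) / (s * t))"
        using p_le[of "s * t" h] s t by (intro mult_left_mono) auto
      then show "t * p h \<le> (g (l + s *\<^sub>R t *\<^sub>R h) - g l) / s" using t by simp
    qed
    have "inverse t * p (t *\<^sub>R h) \<le> p h" using le[of "inverse t" "t *\<^sub>R h"] t by simp
    then show ?thesis using le[OF t, of h] t by (simp add: field_simps)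
  qed
  ultimately show "sublinear p" by (simp add: sublinear_def)
qed

text \<open>A linear functional below the directional derivative at \<open>l\<close> supports \<open>g\<close> there. It is bounded
  because \<open>g\<close>, being continuous, is bounded above near \<open>l\<close>.\<close>

theorem convex_subgradient:
  fixes g :: "'a::real_normed_vector \<Rightarrow> real"
  assumes g: "convex_on UNIV g" and cont: "continuous_on UNIV g"
  obtains f :: "'a \<Rightarrow>\<^sub>L real" where "\<And>u. g l + blinfun_apply f (u - l) \<le> g u"
proof -
  obtain f where lin: "linear f"
    and f_le: "f \<le> (\<lambda>h. INF t\<in>{0<..}. (g (l + t *\<^sub>R h) - g l) / t)"
    using hahn_banach_sublinear[OF sublinear_directional_derivative(1)[OF g, of l]] .
  have f: "f h \<le> g (l + h) - g l" for h
    using le_funD[OF f_le, of h] sublinear_directional_derivative(2)[OF g, of l h] by linarith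
  have "isCont g l" using cont continuous_on_eq_continuous_at by blast
  then obtain e where e: "e > 0" and near: "\<And>u. norm (u - l) < e \<Longrightarrow> \<bar>g u - g l\<bar> < 1"
    unfolding continuous_at_eps_delta by (metis dist_norm dist_real_def zero_less_one)
  have le: "f h \<le> (2 / e) * norm h" for h
  proof (cases "h = 0")
    case True
    then show ?thesis using linear_0[OF lin] by simp
  next
    case False
    define c where "c = e / (2 * norm h)"
    have c: "c > 0" "norm (c *\<^sub>R h) < e" using False e by (auto simp: c_def)
    have "c * f h = f (c *\<^sub>R h)" using linear_scale[OF lin] by simp
    also have "\<dots> \<le> 1" using f[of "c *\<^sub>R h"] near[of "l + c *\<^sub>R h"] c by simp
    finally show ?thesis using False e by (simp add: c_def field_simps)
  qed
  have "bounded_linear f"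
  proof (rule bounded_linear_intro[where K = "2 / e"])
    fix h show "norm (f h) \<le> norm h * (2 / e)"
      using le[of h] le[of "- h"] linear_neg[OF lin, of h] by (simp add: abs_le_iff mult.commute)
  qed (use lin linear_add linear_scale in blast)+
  then have "blinfun_apply (Blinfun f) h = f h" for h by (rule bounded_linear_Blinfun_apply[THEN fun_cong])
  then have "g l + blinfun_apply (Blinfun f) (u - l) \<le> g u" for u
    using f[of "u - l"] by simp
  then show ?thesis by (rule that)
qed

text \<open>A subgradient of the norm at \<open>x\<close>; testing the subgradient inequality at \<open>0\<close> and \<open>2 *\<^sub>R x\<close>
  gives both bounds for its value at \<open>x\<close>.\<close>

lemma norming_functional:
  fixes x :: "'a::real_normed_vector"
  obtains f :: "'a \<Rightarrow>\<^sub>L real" where "norm f \<le> 1" and "blinfun_apply f x = norm x"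
proof -
  have "convex_on UNIV (norm :: 'a \<Rightarrow> real)"
    using convex_on_dist[of UNIV "0 :: 'a"] by simp
  then obtain f :: "'a \<Rightarrow>\<^sub>L real" where f: "\<And>u. norm x + blinfun_apply f (u - x) \<le> norm u"
    using convex_subgradient[of "norm :: 'a \<Rightarrow> real" x] continuous_on_norm_id by blast
  have fx: "blinfun_apply f x = norm x"
    using f[of 0] f[of "2 *\<^sub>R x"]
    by (simp add: blinfun.diff_right blinfun.minus_right blinfun.scaleR_right)
  then have "blinfun_apply f u \<le> norm u" for u
    using f[of u] by (simp add: blinfun.diff_right)
  then have "\<bar>blinfun_apply f u\<bar> \<le> norm u" for u
    by (metis abs_le_iff blinfun.minus_right norm_minus_cancel)
  then have "norm f \<le> 1" by (intro norm_blinfun_bound) auto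
  then show ?thesis using fx that by blast
qed

section \<open>Weak compactness implies weak sequential compactness\<close>
lemma compactin_cluster_point:
  assumes compact: "compactin X U" and v: "\<And>n :: nat. v n \<in> U"
  obtains l where "l \<in> U" and "\<And>V N. openin X V \<Longrightarrow> l \<in> V \<Longrightarrow> \<exists>n\<ge>N. v n \<in> V"
proof (rule ccontr)
  assume "\<not> thesis"
  with that have no: "\<exists>V N. openin X V \<and> l \<in> V \<and> (\<forall>n\<ge>N. v n \<notin> V)" if "l \<in> U" for l
    using \<open>l \<in> U\<close> by meson
  define C where "C = {V. openin X V \<and> eventually (\<lambda>n. v n \<notin> V) sequentially}"
  have "\<forall>V\<in>C. openin X V" and "U \<subseteq> \<Union>C"
    using no by (auto simp: C_def eventually_sequentially) (metis mem_Collect_eq)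
  then obtain F where F: "finite F" "F \<subseteq> C" "U \<subseteq> \<Union>F"
    using compact unfolding compactin_def by meson
  have "eventually (\<lambda>n. \<forall>V\<in>F. v n \<notin> V) sequentially"
    using F by (intro eventually_ball_finite) (auto simp: C_def)
  then obtain n where "\<forall>V\<in>F. v n \<notin> V" by (auto simp: eventually_sequentially)
  then show False using v[of n] F(3) by blast
qed

lemma openin_weak_topology_finite:
  fixes l :: "'a::real_normed_vector" and F :: "('a \<Rightarrow>\<^sub>L real) set"
  assumes "finite F"
  shows "openin weak_topology {x. \<forall>f\<in>F. \<bar>blinfun_apply f x - blinfun_apply f l\<bar> < e}"
proof -
  define W where "W = (\<Inter>f\<in>F. {g :: ('a \<Rightarrow>\<^sub>L real) \<Rightarrow> real. \<bar>g f - blinfun_apply f l\<bar> < e})"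
  have "open W"
    unfolding W_def using assms
    by (intro open_INT ballI open_Collect_less continuous_intros) auto
  moreover have "{x. \<forall>f\<in>F. \<bar>blinfun_apply f x - blinfun_apply f l\<bar> < e} =
      (\<lambda>x f. blinfun_apply f x) -` W \<inter> UNIV"
    by (auto simp: W_def)
  ultimately show ?thesis
    unfolding weak_topology_def openin_pullback_topology by auto
qed

text \<open>Cluster points are described through finitely many functionals at a time, since these
  determine the basic weak neighbourhoods.\<close>

lemma weakly_compact_cluster_point:
  fixes v :: "nat \<Rightarrow> 'a::real_normed_vector"
  assumes "compactin weak_topology U" and "\<And>n. v n \<in> U"
  obtains l where "l \<in> U"
    and "\<And>(F :: ('a \<Rightarrow>\<^sub>L real) set) e N. finite F \<Longrightarrow> e > 0 \<Longrightarrow>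
           \<exists>n\<ge>N. \<forall>f\<in>F. \<bar>blinfun_apply f (v n) - blinfun_apply f l\<bar> < e"
proof -
  obtain l where l: "l \<in> U" "\<And>V N. openin weak_topology V \<Longrightarrow> l \<in> V \<Longrightarrow> \<exists>n\<ge>N. v n \<in> V"
    using compactin_cluster_point[of weak_topology U v, OF assms] by blast
  have "\<exists>n\<ge>N. \<forall>f\<in>F. \<bar>blinfun_apply f (v n) - blinfun_apply f l\<bar> < e"
    if "finite F" "e > 0" for F :: "('a \<Rightarrow>\<^sub>L real) set" and e N
    using l(2)[OF openin_weak_topology_finite[OF that(1), of l e], of N] that(2) by simp
  with l(1) that show ?thesis by blast
qed

lemma convex_on_infdist:
  fixes S :: "'a::real_normed_vector set"
  assumes "convex S" and "S \<noteq> {}"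
  shows "convex_on UNIV (\<lambda>x. infdist x S)"
proof (rule convex_onI)
  fix t :: real and x y :: 'a
  assume t: "0 < t" "t < 1"
  show "infdist ((1 - t) *\<^sub>R x + t *\<^sub>R y) S \<le> (1 - t) * infdist x S + t * infdist y S"
  proof (rule field_le_epsilon)
    fix e :: real assume e: "e > 0"
    have near: "\<exists>a\<in>S. dist x a < infdist x S + e" for x
    proof (rule ccontr)
      assume "\<not> ?thesis"
      then have "infdist x S + e \<le> infdist x S"
        unfolding infdist_notempty[OF assms(2)]
        by (intro cINF_greatest[OF assms(2)]) (auto simp: not_less)
      with e show False by simp
    qed
    obtain a b where a: "a \<in> S" "dist x a < infdist x S + e" and b: "b \<in> S" "dist y b < infdist y S + e"
      using near by meson
    have "(1 - t) *\<^sub>R a + t *\<^sub>R b \<in> S"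
      using assms(1) a(1) b(1) t by (simp add: convex_def)
    then have "infdist ((1 - t) *\<^sub>R x + t *\<^sub>R y) S
        \<le> dist ((1 - t) *\<^sub>R x + t *\<^sub>R y) ((1 - t) *\<^sub>R a + t *\<^sub>R b)"
      by (rule infdist_le)
    also have "\<dots> = norm ((1 - t) *\<^sub>R (x - a) + t *\<^sub>R (y - b))"
      by (simp add: dist_norm algebra_simps)
    also have "\<dots> \<le> (1 - t) * dist x a + t * dist y b"
      using norm_triangle_ineq[of "(1 - t) *\<^sub>R (x - a)" "t *\<^sub>R (y - b)"] t by (simp add: dist_norm)
    also have "\<dots> \<le> (1 - t) * (infdist x S + e) + t * (infdist y S + e)"
      using a(2) b(2) t by (intro add_mono mult_left_mono) auto
    finally show "infdist ((1 - t) *\<^sub>R x + t *\<^sub>R y) S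
        \<le> (1 - t) * infdist x S + t * infdist y S + e"
      by (simp add: algebra_simps)
  qed
qed auto

text \<open>A subgradient at \<open>l\<close> of the distance from \<open>Y\<close> separates \<open>l\<close> from \<open>Y\<close> if \<open>l\<close> lies outside.\<close>

lemma weak_cluster_point_in_closed_convex:
  fixes v :: "nat \<Rightarrow> 'a::real_normed_vector"
  assumes Y: "closed Y" "convex Y" and v: "\<And>n. v n \<in> Y"
    and cluster: "\<And>(f :: 'a \<Rightarrow>\<^sub>L real) e. e > 0 \<Longrightarrow> \<exists>n. \<bar>blinfun_apply f (v n) - blinfun_apply f l\<bar> < e"
  shows "l \<in> Y"
proof (rule ccontr)
  assume "l \<notin> Y"
  have "Y \<noteq> {}" using v by auto
  then have pos: "infdist l Y > 0"
    using infdist_pos_not_in_closed[OF Y(1)] \<open>l \<notin> Y\<close> by blast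
  have "continuous_on UNIV (\<lambda>u. infdist u Y)" by (intro continuous_intros)
  then obtain f :: "'a \<Rightarrow>\<^sub>L real" where f: "\<And>u. infdist l Y + blinfun_apply f (u - l) \<le> infdist u Y"
    using convex_subgradient[OF convex_on_infdist[OF Y(2) \<open>Y \<noteq> {}\<close>], of l] by blast
  obtain n where "\<bar>blinfun_apply f (v n) - blinfun_apply f l\<bar> < infdist l Y"
    using cluster[OF pos] by blast
  with f[of "v n"] v[of n] show False by (simp add: blinfun.diff_right)
qed

text \<open>Coefficients are restricted to rationals, and combinations are indexed by lists, so that the set
  is visibly countable; its closure is the closed linear span of the sequence.\<close>

definition rational_combinations :: "(nat \<Rightarrow> 'a::real_vector) \<Rightarrow> 'a set" where
  "rational_combinations v = range (\<lambda>xs. \<Sum>(q, n)\<leftarrow>xs. real_of_rat q *\<^sub>R v n)"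

lemma countable_rational_combinations: "countable (rational_combinations v)"
  by (simp add: rational_combinations_def)

lemma rational_combinations_base: "v n \<in> rational_combinations v"
  unfolding rational_combinations_def by (rule range_eqI[of _ _ "[(1, n)]"]) simp

lemma rational_combinations_0: "0 \<in> rational_combinations v"
  unfolding rational_combinations_def by (rule range_eqI[of _ _ "[]"]) simp

lemma rational_combinations_add:
  assumes "x \<in> rational_combinations v" and "y \<in> rational_combinations v"
  shows "x + y \<in> rational_combinations v"
proof -
  obtain xs ys where "x = (\<Sum>(q, n)\<leftarrow>xs. real_of_rat q *\<^sub>R v n)"
    and "y = (\<Sum>(q, n)\<leftarrow>ys. real_of_rat q *\<^sub>R v n)"
    using assms by (auto simp: rational_combinations_def)
  then have "x + y = (\<Sum>(q, n)\<leftarrow>xs @ ys. real_of_rat q *\<^sub>R v n)" by simp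
  then show ?thesis unfolding rational_combinations_def by blast
qed

lemma rational_combinations_scale:
  assumes "x \<in> rational_combinations v"
  shows "real_of_rat r *\<^sub>R x \<in> rational_combinations v"
proof -
  obtain xs where x: "x = (\<Sum>(q, n)\<leftarrow>xs. real_of_rat q *\<^sub>R v n)"
    using assms by (auto simp: rational_combinations_def)
  have "real_of_rat r *\<^sub>R x = (\<Sum>(q, n)\<leftarrow>map (\<lambda>(q, n). (r * q, n)) xs. real_of_rat q *\<^sub>R v n)"
    unfolding x by (induction xs) (auto simp: of_rat_mult scaleR_add_right)
  then show ?thesis unfolding rational_combinations_def by blast
qed

lemma subspace_closure_rational_combinations:
  fixes v :: "nat \<Rightarrow> 'a::real_normed_vector"
  shows "subspace (closure (rational_combinations v))" (is "subspace (closure ?D)")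
  unfolding subspace_def
proof (intro conjI ballI allI)
  show "0 \<in> closure ?D" using rational_combinations_0 closure_subset by blast
next
  fix x y assume "x \<in> closure ?D" "y \<in> closure ?D"
  then obtain a b where "\<forall>n. a n \<in> ?D" "a \<longlonglongrightarrow> x" "\<forall>n. b n \<in> ?D" "b \<longlonglongrightarrow> y"
    unfolding closure_sequential by blast
  then have "\<forall>n. a n + b n \<in> ?D" "(\<lambda>n. a n + b n) \<longlonglongrightarrow> x + y"
    by (auto intro: rational_combinations_add tendsto_add)
  then show "x + y \<in> closure ?D" unfolding closure_sequential by (intro exI[of _ "\<lambda>n. a n + b n"]) simp
next
  fix c :: real and x assume "x \<in> closure ?D"
  then obtain a where a: "\<forall>n. a n \<in> ?D" "a \<longlonglongrightarrow> x"
    unfolding closure_sequential by blast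
  have "c \<in> closure \<rat>" by (simp add: Rats_closure_real)
  then obtain q where q: "\<forall>n. q n \<in> \<rat>" "q \<longlonglongrightarrow> c"
    unfolding closure_sequential by blast
  have "q n *\<^sub>R a n \<in> ?D" for n
    using q(1) a(1) rational_combinations_scale[of "a n" v] by (metis Rats_cases)
  moreover have "(\<lambda>n. q n *\<^sub>R a n) \<longlonglongrightarrow> c *\<^sub>R x" by (intro tendsto_scaleR q a)
  ultimately show "c *\<^sub>R x \<in> closure ?D" unfolding closure_sequential by (intro exI[of _ "\<lambda>n. q n *\<^sub>R a n"]) simp
qed

text \<open>The norming functionals of the points of \<open>D\<close> suffice: if they all vanish at \<open>y\<close> and \<open>d \<in> D\<close> is close to
  \<open>y\<close>, then \<open>norm d\<close> is the value of one of them at \<open>d - y\<close> and hence small.\<close>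

lemma countable_separating_functionals:
  fixes D :: "'a::real_normed_vector set"
  assumes "countable D"
  obtains G :: "nat \<Rightarrow> 'a \<Rightarrow>\<^sub>L real"
  where "\<And>y. y \<in> closure D \<Longrightarrow> (\<And>k. blinfun_apply (G k) y = 0) \<Longrightarrow> y = 0"
proof -
  obtain \<nu> :: "'a \<Rightarrow> 'a \<Rightarrow>\<^sub>L real" where \<nu>: "\<And>d. norm (\<nu> d) \<le> 1" "\<And>d. blinfun_apply (\<nu> d) d = norm d"
    using norming_functional by metis
  define G where "G k = \<nu> (from_nat_into D k)" for k
  have "y = 0" if y: "y \<in> closure D" and zero: "\<And>k. blinfun_apply (G k) y = 0" for y
  proof -
    have "norm y \<le> 0 + e" if "e > 0" for e
    proof -
      have "e / 2 > 0" using that by simp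
      then obtain d where d: "d \<in> D" "dist d y < e / 2"
        using y unfolding closure_approachable by blast
      obtain k where "from_nat_into D k = d" using d(1) assms by (metis from_nat_into_surj)
      then have "norm d = blinfun_apply (\<nu> d) (d - y)"
        using zero[of k] \<nu>(2)[of d] by (simp add: G_def blinfun.diff_right)
      also have "\<dots> \<le> norm (\<nu> d) * norm (d - y)"
        using norm_blinfun[of "\<nu> d" "d - y"] by simp
      also have "\<dots> \<le> norm (d - y)"
        using mult_right_mono[OF \<nu>(1)[of d], of "norm (d - y)"] by simp
      finally show ?thesis
        using d(2) norm_triangle_sub[of y d] by (simp add: dist_norm norm_minus_commute)
    qed
    then have "norm y \<le> 0" by (rule field_le_epsilon)
    then show ?thesis by simp
  qed
  then show ?thesis by (rule that)
qed

text \<open>The sequence lives in a separable closed subspace \<open>closure D\<close>, which by Mazur's theorem contains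
  all its weak cluster points, and on which countably many functionals \<open>G k\<close> separate points. The
  subsequence is chosen so that every \<open>G k\<close> converges along it to its value at one fixed cluster point
  \<open>l\<close>. Then every further subsequence has only \<open>l\<close> as a cluster point, and by
  compactness the subsequence converges weakly to \<open>l\<close>.\<close>

theorem weakly_compact_imp_weakly_seq_compact:
  fixes v :: "nat \<Rightarrow> 'a::real_normed_vector"
  assumes compact: "compactin weak_topology U" and v: "\<And>n. v n \<in> U"
  obtains l r where "l \<in> U" and "strict_mono (r :: nat \<Rightarrow> nat)"
    and "limitin weak_topology (v \<circ> r) l sequentially"
proof -
  define D where "D = rational_combinations v"
  have Y: "subspace (closure D)"
    unfolding D_def by (rule subspace_closure_rational_combinations)
  have vY: "v n \<in> closure D" for n
    unfolding D_def using subsetD[OF closure_subset rational_combinations_base] .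
  obtain G :: "nat \<Rightarrow> 'a \<Rightarrow>\<^sub>L real"
    where G: "\<And>y. y \<in> closure D \<Longrightarrow> (\<And>k. blinfun_apply (G k) y = 0) \<Longrightarrow> y = 0"
    using countable_separating_functionals[of D] countable_rational_combinations[of v]
    unfolding D_def by blast
  obtain l where lU: "l \<in> U" and l: "\<And>(F :: ('a \<Rightarrow>\<^sub>L real) set) e N. finite F \<Longrightarrow> e > 0 \<Longrightarrow>
      \<exists>n\<ge>N. \<forall>f\<in>F. \<bar>blinfun_apply f (v n) - blinfun_apply f l\<bar> < e"
    using weakly_compact_cluster_point[of U v, OF compact v] by blast
  have "\<exists>n. (\<forall>k\<le>j. \<bar>blinfun_apply (G k) (v n) - blinfun_apply (G k) l\<bar> < 1 / Suc j) \<and> N < n" for j N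
  proof -
    obtain n where "n \<ge> Suc N"
      and "\<forall>f\<in>G ` {..j}. \<bar>blinfun_apply f (v n) - blinfun_apply f l\<bar> < 1 / Suc j"
      using l[of "G ` {..j}" "1 / Suc j" "Suc N"] by fastforce
    then show ?thesis by (intro exI[of _ n]) auto
  qed
  then obtain next_index
    where close: "\<And>j N k. k \<le> j \<Longrightarrow>
        \<bar>blinfun_apply (G k) (v (next_index j N)) - blinfun_apply (G k) l\<bar> < 1 / Suc j"
      and next_less: "\<And>j N. N < next_index j N"
    by metis
  define r where "r = rec_nat (next_index 0 0) (\<lambda>j. next_index (Suc j))"
  have r: "\<bar>blinfun_apply (G k) (v (r j)) - blinfun_apply (G k) l\<bar> < 1 / Suc j" if "k \<le> j" for j k
    using close[OF that] that by (cases j) (auto simp: r_def)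
  have r_less: "r j < r (Suc j)" for j
    using next_less by (simp add: r_def)
  have Glim: "(\<lambda>j. blinfun_apply (G k) (v (r j))) \<longlonglongrightarrow> blinfun_apply (G k) l" for k
  proof (rule LIM_zero_cancel, rule Lim_null_comparison[OF _ LIMSEQ_Suc[OF lim_1_over_n]])
    show "\<forall>\<^sub>F j in sequentially.
        norm (blinfun_apply (G k) (v (r j)) - blinfun_apply (G k) l) \<le> 1 / of_nat (Suc j)"
      unfolding eventually_sequentially using r by (intro exI[of _ k]) (auto intro: less_imp_le)
  qed
  \<comment> \<open>\<open>s\<close> is only required to tend to infinity: a counterexample to convergence provides such
    an \<open>s\<close> directly, without monotonicity.\<close>
  have cluster_l: "\<exists>n. \<bar>blinfun_apply f (v (r (s n))) - blinfun_apply f l\<bar> < e"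
    if s: "\<And>n. s n \<ge> n" and e: "e > 0" for s e and f :: "'a \<Rightarrow>\<^sub>L real"
  proof -
    obtain m where "m \<in> U" and m: "\<And>(F :: ('a \<Rightarrow>\<^sub>L real) set) e N. finite F \<Longrightarrow> e > 0 \<Longrightarrow>
        \<exists>n\<ge>N. \<forall>f\<in>F. \<bar>blinfun_apply f (v (r (s n))) - blinfun_apply f m\<bar> < e"
      using weakly_compact_cluster_point[of U "\<lambda>n. v (r (s n))", OF compact v] by blast
    have single: "\<exists>n\<ge>N. \<bar>blinfun_apply f (v (r (s n))) - blinfun_apply f m\<bar> < e" if "e > 0" for f :: "'a \<Rightarrow>\<^sub>L real" and e N
      using m[of "{f}" e N] that by simp
    have single_l: "\<exists>n. \<bar>blinfun_apply f (v n) - blinfun_apply f l\<bar> < e" if "e > 0" for f :: "'a \<Rightarrow>\<^sub>L real" and e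
      using l[of "{f}" e 0] that by auto
    have "blinfun_apply (G k) (l - m) = 0" for k
    proof -
      have "\<bar>blinfun_apply (G k) (l - m)\<bar> \<le> 0 + e" if pos: "e > 0" for e
      proof -
        obtain N where N: "\<And>j. j \<ge> N \<Longrightarrow> \<bar>blinfun_apply (G k) (v (r j)) - blinfun_apply (G k) l\<bar> < e / 2"
          using LIMSEQ_D[OF Glim half_gt_zero[OF pos]] by (auto simp only: real_norm_def)
        obtain n where n: "n \<ge> N" "\<bar>blinfun_apply (G k) (v (r (s n))) - blinfun_apply (G k) m\<bar> < e / 2"
          using single[OF half_gt_zero[OF pos]] by blast
        have "s n \<ge> N" using n(1) s[of n] by linarith
        from N[OF this] n(2) show ?thesis unfolding blinfun.diff_right by linarith
      qed
      then have "\<bar>blinfun_apply (G k) (l - m)\<bar> \<le> 0" by (rule field_le_epsilon)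
      then show ?thesis by simp
    qed
    moreover have "l - m \<in> closure D"
    proof (rule subspace_diff[OF Y])
      note Yc = closed_closure subspace_imp_convex[OF Y]
      show "l \<in> closure D" by (rule weak_cluster_point_in_closed_convex[OF Yc vY single_l])
      show "m \<in> closure D"
        by (rule weak_cluster_point_in_closed_convex[OF Yc, of "\<lambda>n. v (r (s n))"])
          (use vY single in blast)+
    qed
    ultimately have "l = m" using G[of "l - m"] by simp
    then show ?thesis using single[OF e, of 0 f] by blast
  qed
  have "(\<lambda>n. blinfun_apply f (v (r n))) \<longlonglongrightarrow> blinfun_apply f l" for f :: "'a \<Rightarrow>\<^sub>L real"
  proof (rule ccontr)
    assume "\<not> ?thesis"
    then obtain e where e: "e > 0"
      and "\<And>N. \<exists>n\<ge>N. \<not> \<bar>blinfun_apply f (v (r n)) - blinfun_apply f l\<bar> < e"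
      unfolding LIMSEQ_iff by (auto simp: not_less)
    then obtain s where "\<And>N. s N \<ge> N" "\<And>N. \<not> \<bar>blinfun_apply f (v (r (s N))) - blinfun_apply f l\<bar> < e"
      by metis
    with cluster_l[of s e f] e show False by blast
  qed
  then have "limitin weak_topology (v \<circ> r) l sequentially"
    by (simp add: limitin_weak_topology_iff)
  with lU r_less that show ?thesis by (auto simp: strict_mono_Suc_iff)
qed

section \<open>Continuous dependence of solutions: the monotone case\<close>
lemma norm_blinfun_le_of_unit_ball:
  fixes f :: "'a::real_normed_vector \<Rightarrow>\<^sub>L real"
  assumes b: "\<And>v. norm v \<le> 1 \<Longrightarrow> blinfun_apply f v \<le> b"
  shows "norm f \<le> b"
proof (rule norm_blinfun_bound)
  show "0 \<le> b" using b[of 0] by simp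
  fix x
  show "norm (blinfun_apply f x) \<le> b * norm x"
  proof (cases "x = 0")
    case False
    define v where "v = (1 / norm x) *\<^sub>R x"
    have v: "norm v \<le> 1" "blinfun_apply f v = blinfun_apply f x / norm x"
      using False by (auto simp: v_def blinfun.scaleR_right)
    show ?thesis
      using b[of v] b[of "- v"] v False
      by (simp add: blinfun.minus_right field_simps abs_le_iff)
  qed simp
qed

text \<open>With \<open>w = N x0 - N x\<close> and \<open>\<delta> = h - h0\<close> one has \<open>x - x0 = \<delta> - K w\<close>. Monotonicity against
  \<open>x0 + v\<close>, where \<open>N\<close> is bounded for \<open>norm v \<le> 1\<close>, estimates \<open>w v\<close> by
  \<open>w \<delta> - w (K w)\<close> plus a term of order \<open>1 + norm (K w)\<close>. The quadratic term \<open>- d * (norm (K w))\<^sup>2\<close>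
  hidden in \<open>- w (K w)\<close> absorbs the linear growth in \<open>norm (K w)\<close>, and for
  \<open>norm \<delta> \<le> 1 / 2\<close> the supremum over \<open>v\<close> absorbs \<open>w \<delta>\<close>. This bounds \<open>norm w\<close> independently of
  \<open>x\<close>; monotonicity against \<open>x0\<close> itself then gives the estimate.\<close>

lemma monotone_perturbation_estimate:
  fixes K :: "('x::real_normed_vector \<Rightarrow>\<^sub>L real) \<Rightarrow> 'x"
  assumes K: "linear K" and d: "d > 0" "\<And>f. d * (norm (K f))\<^sup>2 \<le> blinfun_apply f (K f)"
    and bnd: "bounded_map N" and mono: "negatively_monotone N"
    and x0: "x0 = K (N x0) + h0"
  obtains B where "B \<ge> 0"
    and "\<And>x h. x = K (N x) + h \<Longrightarrow> norm (h - h0) \<le> 1 / 2 \<Longrightarrow>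
           d * (norm ((x - x0) - (h - h0)))\<^sup>2 \<le> B * norm (h - h0)"
proof -
  have "bounded (N ` cball x0 1)" using bnd by (simp add: bounded_map_def)
  then obtain C where C: "\<And>y. y \<in> cball x0 1 \<Longrightarrow> norm (N y - N x0) \<le> C"
    unfolding bounded_any_center[where a = "N x0"] by (metis dist_norm dist_commute imageI)
  have C0: "C \<ge> 0" using C[of x0] by simp
  \<comment> \<open>\<open>C\<^sup>2 / (4 * d)\<close> is the maximum of \<open>C * s - d * s\<^sup>2\<close>; the rest collects the terms independent
    of \<open>s\<close>.\<close>
  define B where "B = 3 * C / 2 + C\<^sup>2 / (4 * d)"
  have B0: "B \<ge> 0" using C0 d by (simp add: B_def)
  have est: "d * (norm ((x - x0) - (h - h0)))\<^sup>2 \<le> (2 * B) * norm (h - h0)"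
    if x: "x = K (N x) + h" and small: "norm (h - h0) \<le> 1 / 2" for x h
  proof -
    define \<delta> where "\<delta> = h - h0"
    define w where "w = N x0 - N x"
    define s where "s = norm (K w)"
    have z: "x - x0 = \<delta> - K w"
      using x x0 by (simp add: \<delta>_def w_def linear_diff[OF K] algebra_simps)
    have ws: "d * s\<^sup>2 \<le> blinfun_apply w (K w)" using d(2) by (simp add: s_def)
    have w\<delta>: "blinfun_apply w \<delta> \<le> norm w * norm \<delta>"
      using norm_blinfun[of w \<delta>] by simp
    have "blinfun_apply w v \<le> norm w / 2 + B" if v: "norm v \<le> 1" for v
    proof -
      define p where "p = N x0 - N (x0 + v)"
      have p: "norm p \<le> C"
        using C[of "x0 + v"] v by (simp add: p_def dist_norm norm_minus_commute)
      have "blinfun_apply (N x - N (x0 + v)) (x - (x0 + v)) \<le> 0"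
        using mono by (simp add: negatively_monotone_def)
      moreover have "N x - N (x0 + v) = p - w" by (simp add: p_def w_def)
      moreover have "x - (x0 + v) = \<delta> - K w - v" using z by (simp add: algebra_simps)
      ultimately have "blinfun_apply w v \<le>
          blinfun_apply w \<delta> + - blinfun_apply w (K w) + - blinfun_apply p (\<delta> - K w - v)"
        by (simp add: blinfun.diff_left blinfun.diff_right)
      also have "- blinfun_apply p (\<delta> - K w - v) \<le> C * (1 / 2 + s + 1)"
      proof -
        have "- blinfun_apply p (\<delta> - K w - v) \<le> norm p * norm (\<delta> - K w - v)"
          using norm_blinfun[of p "\<delta> - K w - v"] by simp
        also have "\<dots> \<le> C * (1 / 2 + s + 1)"
          using norm_triangle_ineq4[of "\<delta> - K w" v] norm_triangle_ineq4[of \<delta> "K w"] small v p C0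
          by (intro mult_mono) (auto simp: \<delta>_def s_def)
        finally show ?thesis .
      qed
      also have "blinfun_apply w \<delta> \<le> norm w / 2"
        using w\<delta> mult_left_mono[OF small[folded \<delta>_def], of "norm w"] by simp
      also have "- blinfun_apply w (K w) \<le> - (d * s\<^sup>2)" using ws by simp
      finally have "blinfun_apply w v \<le> norm w / 2 + (C * s - d * s\<^sup>2) + 3 * C / 2"
        by (simp add: algebra_simps)
      moreover have "C * s - d * s\<^sup>2 \<le> C\<^sup>2 / (4 * d)"
      proof -
        have "0 \<le> (2 * d * s - C)\<^sup>2" by simp
        then show ?thesis using d(1) by (simp add: field_simps power2_eq_square)
      qed
      ultimately show ?thesis by (simp add: B_def)
    qed
    then have "norm w \<le> norm w / 2 + B" by (rule norm_blinfun_le_of_unit_ball)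
    then have w: "norm w \<le> 2 * B" by simp
    have "blinfun_apply (N x - N x0) (x - x0) \<le> 0"
      using mono by (simp add: negatively_monotone_def)
    moreover have "N x - N x0 = - w" by (simp add: w_def)
    ultimately have "blinfun_apply w (K w) \<le> blinfun_apply w \<delta>"
      unfolding z by (simp add: blinfun.diff_right blinfun.minus_left)
    then have "d * s\<^sup>2 \<le> norm w * norm \<delta>" using ws w\<delta> by linarith
    also have "\<dots> \<le> (2 * B) * norm \<delta>" using w by (intro mult_right_mono) auto
    finally show ?thesis using z by (simp add: s_def \<delta>_def)
  qed
  show ?thesis by (rule that[of "2 * B"]) (use B0 est in auto)
qed

lemma monotone_solutions_tendsto:
  fixes K :: "('x::real_normed_vector \<Rightarrow>\<^sub>L real) \<Rightarrow> 'x"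
  assumes K: "linear K" and d: "d > 0" "\<And>f. d * (norm (K f))\<^sup>2 \<le> blinfun_apply f (K f)"
    and N: "bounded_map N" "negatively_monotone N"
    and x0: "x0 = K (N x0) + h0" and x: "\<And>n. x n = K (N (x n)) + h n"
    and h: "h \<longlonglongrightarrow> h0"
  shows "x \<longlonglongrightarrow> x0"
proof -
  obtain B where B: "B \<ge> 0" and est: "\<And>x h. x = K (N x) + h \<Longrightarrow> norm (h - h0) \<le> 1 / 2 \<Longrightarrow>
      d * (norm ((x - x0) - (h - h0)))\<^sup>2 \<le> B * norm (h - h0)"
    using monotone_perturbation_estimate[OF K d N x0] by blast
  have \<delta>: "(\<lambda>n. h n - h0) \<longlonglongrightarrow> 0" using h by (rule LIM_zero)
  have "(\<lambda>n. (x n - x0) - (h n - h0)) \<longlonglongrightarrow> 0"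
  proof (rule Lim_null_comparison)
    have "\<forall>\<^sub>F n in sequentially. norm (h n - h0) < 1 / 2"
      using order_tendstoD(2)[OF tendsto_norm[OF \<delta>], of "1 / 2"] by simp
    then show "\<forall>\<^sub>F n in sequentially. norm ((x n - x0) - (h n - h0)) \<le> sqrt (B * norm (h n - h0) / d)"
    proof eventually_elim
      case (elim n)
      then show ?case
        using est[OF x, of n] d(1) by (intro real_le_rsqrt) (simp add: field_simps)
    qed
    show "(\<lambda>n. sqrt (B * norm (h n - h0) / d)) \<longlonglongrightarrow> 0"
      using d(1) by (auto intro!: tendsto_eq_intros h)
  qed
  from tendsto_add[OF this \<delta>] show ?thesis by (simp add: LIM_zero_iff)
qed

section \<open>Continuous dependence of solutions: the Hilbert space case\<close>

lemma hilbert_inner_props: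
  assumes "hilbert_inner ip"
  shows hilbert_inner_commute: "ip a b = ip b a"
    and hilbert_inner_add_left: "ip (a + b) c = ip a c + ip b c"
    and hilbert_inner_scale_left: "ip (r *\<^sub>R a) b = r * ip a b"
    and hilbert_inner_norm: "ip a a = (norm a)\<^sup>2"
  using assms unfolding hilbert_inner_def by blast+

lemma hilbert_inner_add_right:
  assumes "hilbert_inner ip"
  shows "ip a (b + c) = ip a b + ip a c"
  using hilbert_inner_add_left[OF assms, of b c a]
  by (simp only: hilbert_inner_commute[OF assms, of a])

lemma hilbert_inner_scale_right:
  assumes "hilbert_inner ip"
  shows "ip a (r *\<^sub>R b) = r * ip a b"
  using hilbert_inner_scale_left[OF assms, of r b a]
  by (simp only: hilbert_inner_commute[OF assms, of a])

lemma hilbert_inner_norm_add: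
  assumes "hilbert_inner ip"
  shows "(norm (x + y))\<^sup>2 = (norm x)\<^sup>2 + 2 * ip x y + (norm y)\<^sup>2"
  unfolding hilbert_inner_norm[OF assms, symmetric] hilbert_inner_add_left[OF assms]
    hilbert_inner_add_right[OF assms]
  using hilbert_inner_commute[OF assms, of x y] by simp

text \<open>The representing vector of \<open>f\<close> minimizes the energy \<open>J x = (norm x)\<^sup>2 - 2 * f x\<close>. Minimizing
  sequences are Cauchy by the parallelogram law, and the first variation at the minimizer vanishes.
  Surjectivity is what makes \<open>inv (riesz ip)\<close> a genuine inverse, so that strong monotonicity of
  \<open>inv (riesz ip) \<circ> N\<close> is a property of \<open>N\<close>.\<close>

theorem riesz_surj:
  fixes ip :: "'x::banach \<Rightarrow> 'x \<Rightarrow> real"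
  assumes ip: "hilbert_inner ip"
  shows "surj (riesz ip)"
  unfolding surj_def
proof
  fix f :: "'x \<Rightarrow>\<^sub>L real"
  note sq_add = hilbert_inner_norm_add[OF ip]
  note scale = hilbert_inner_scale_right[OF ip]
  define J where "J x = (norm x)\<^sup>2 - 2 * blinfun_apply f x" for x
  have J_ge: "- (norm f)\<^sup>2 \<le> J x" for x
  proof -
    have "blinfun_apply f x \<le> norm f * norm x" using norm_blinfun[of f x] by simp
    moreover have "0 \<le> (norm x - norm f)\<^sup>2" by simp
    ultimately show ?thesis by (simp add: J_def power2_eq_square algebra_simps)
  qed
  have bdd: "bdd_below (range J)" using J_ge by (intro bdd_belowI2) auto
  define m where "m = Inf (range J)"
  have m_le: "m \<le> J x" for x unfolding m_def by (rule cINF_lower[OF bdd]) simp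
  have "\<exists>x. J x < m + inverse (real (Suc n))" for n
    using cInf_lessD[of "range J" "m + inverse (real (Suc n))"] by (auto simp: m_def)
  then obtain x where x: "\<And>n. J (x n) < m + inverse (real (Suc n))" by metis
  have par: "(norm (a - b))\<^sup>2 \<le> 2 * ((J a - m) + (J b - m))" for a b
  proof -
    have "(norm (a + b))\<^sup>2 + (norm (a - b))\<^sup>2 = 2 * (norm a)\<^sup>2 + 2 * (norm b)\<^sup>2"
      using sq_add[of a b] sq_add[of a "- b"] scale[where r = "- 1"] by simp
    moreover have "4 * J ((1 / 2) *\<^sub>R (a + b)) = (norm (a + b))\<^sup>2 - 4 * (blinfun_apply f a + blinfun_apply f b)"
      by (simp add: J_def blinfun.scaleR_right blinfun.add_right power_mult_distrib power2_eq_square)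
        argo
    moreover have "4 * m \<le> 4 * J ((1 / 2) *\<^sub>R (a + b))" using m_le by simp
    ultimately show ?thesis unfolding J_def by argo
  qed
  have "Cauchy x"
  proof (rule CauchyI)
    fix e :: real assume e: "e > 0"
    obtain M where M: "inverse (real (Suc M)) < e\<^sup>2 / 4"
      using reals_Archimedean[of "e\<^sup>2 / 4"] e by auto
    have "norm (x i - x j) < e" if "i \<ge> M" "j \<ge> M" for i j
    proof -
      have small: "J (x k) - m < e\<^sup>2 / 4" if "k \<ge> M" for k
      proof -
        have "inverse (real (Suc k)) \<le> inverse (real (Suc M))" using that by (simp add: field_simps)
        then show ?thesis using x[of k] M by linarith
      qed
      have "(norm (x i - x j))\<^sup>2 \<le> 2 * ((J (x i) - m) + (J (x j) - m))" by (rule par)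
      also have "\<dots> < 2 * (e\<^sup>2 / 4 + e\<^sup>2 / 4)"
        using add_strict_mono[OF small[OF that(1)] small[OF that(2)]] by simp
      finally have "(norm (x i - x j))\<^sup>2 < e\<^sup>2" by simp
      then show ?thesis using e by (simp add: power_less_imp_less_base)
    qed
    then show "\<exists>M. \<forall>i\<ge>M. \<forall>j\<ge>M. norm (x i - x j) < e" by blast
  qed
  then obtain y where y: "x \<longlonglongrightarrow> y" using Cauchy_convergent_iff convergent_def by blast
  have "J y \<le> m"
  proof (rule LIMSEQ_le)
    show "(\<lambda>n. J (x n)) \<longlonglongrightarrow> J y"
      unfolding J_def by (intro tendsto_intros y)
    show "(\<lambda>n. m + inverse (real (Suc n))) \<longlonglongrightarrow> m"
      using tendsto_add[OF tendsto_const LIMSEQ_inverse_real_of_nat, of m] by simp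
    show "\<exists>N. \<forall>n\<ge>N. J (x n) \<le> m + inverse (real (Suc n))" using x less_imp_le by blast
  qed
  then have min: "J y \<le> J (y + u)" for u using m_le[of "y + u"] by linarith
  have "blinfun_apply f u = ip y u" for u
  proof -
    define D where "D = ip y u - blinfun_apply f u"
    have quad: "0 \<le> 2 * t * D + t\<^sup>2 * (norm u)\<^sup>2" for t
      using min[of "t *\<^sub>R u"] sq_add[of y "t *\<^sub>R u"] scale[of y t u]
      by (simp add: J_def D_def blinfun.add_right blinfun.scaleR_right power_mult_distrib algebra_simps)
    have "D = 0"
    proof (rule ccontr)
      assume "D \<noteq> 0"
      \<comment> \<open>Adding \<open>1\<close> to the denominator keeps it positive for \<open>u = 0\<close> as well.\<close>
      define t where "t = - D / (1 + (norm u)\<^sup>2)"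
      have pos: "1 + (norm u)\<^sup>2 > 0" by (simp add: add_pos_nonneg)
      have "t * (1 + (norm u)\<^sup>2) = - D" using pos by (simp add: t_def)
      then have D: "D = - (t * (1 + (norm u)\<^sup>2))" by simp
      have "t \<noteq> 0" using \<open>D \<noteq> 0\<close> D by auto
      then have "t\<^sup>2 > 0" by simp
      moreover have "0 \<le> - (t\<^sup>2 * (2 + (norm u)\<^sup>2))"
        using quad[of t] unfolding D by (simp add: power2_eq_square algebra_simps)
      moreover have "t\<^sup>2 * (2 + (norm u)\<^sup>2) > 0" using \<open>t\<^sup>2 > 0\<close> by (simp add: add_pos_nonneg)
      ultimately show False by linarith
    qed
    then show ?thesis by (simp add: D_def)
  qed
  then have "f = riesz ip y" by (intro blinfun_eqI) (simp add: riesz_apply[OF ip])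
  then show "\<exists>y. f = riesz ip y" by blast
qed

lemma mu_pos_imp_class_M:
  assumes ip: "hilbert_inner ip" and "mu ip P > 0"
  shows "class_M ip P"
proof -
  obtain c where c: "0 < ereal c" "ereal c < mu ip P" using assms(2) ereal_dense2 by blast
  have "ip (P x - P y) (x - y) \<ge> c * (norm (x - y))\<^sup>2" if "x \<noteq> y" for x y
  proof -
    have "mu ip P \<le> ereal (ip (P x - P y) (x - y) / (norm (x - y))\<^sup>2)"
      unfolding mu_def using that by (intro INF_lower2[of "(x, y)"]) auto
    then have "ereal c < ereal (ip (P x - P y) (x - y) / (norm (x - y))\<^sup>2)" using c(2) by order
    then show ?thesis using that by (simp add: pos_less_divide_eq less_imp_le)
  qed
  moreover have "ip z 0 = 0" for z using riesz_apply[OF ip, of z 0] by simp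
  ultimately have "ip (P x - P y) (x - y) \<ge> c * (norm (x - y))\<^sup>2" for x y by (cases "x = y") auto
  then show ?thesis using c(1) by (auto simp: class_M_def)
qed

text \<open>Here \<open>f\<close> and \<open>f0\<close> play the role of \<open>N x\<close> and \<open>N x0\<close> in the Hilbert space, \<open>k\<close> and \<open>k0\<close> that of their
  images under \<open>K\<close>. Both monotonicity constants enter with the favourable sign, and
  \<open>c * (norm w)\<^sup>2\<close> absorbs the inner product of \<open>w = f - f0\<close> with \<open>h - h0\<close>.\<close>

lemma strongly_monotone_perturbation_estimate:
  fixes ip :: "'x::real_normed_vector \<Rightarrow> 'x \<Rightarrow> real"
  assumes ip: "hilbert_inner ip" and c: "c > 0"
    and K: "c * (norm (f - f0))\<^sup>2 \<le> ip (k - k0) (f - f0)"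
    and N: "m * (norm (x - x0))\<^sup>2 \<le> ip (f0 - f) (x - x0)"
    and x: "x = k + h" and x0: "x0 = k0 + h0"
  shows "m * (norm (x - x0))\<^sup>2 \<le> (norm (h - h0))\<^sup>2 / (4 * c)"
proof -
  note comm = hilbert_inner_commute[OF ip] and add = hilbert_inner_add_left[OF ip]
    and scale = hilbert_inner_scale_left[OF ip]
  define w where "w = f - f0"
  define \<delta> where "\<delta> = h - h0"
  have "f0 - f = (- 1) *\<^sub>R w" by (simp add: w_def)
  then have "ip (f0 - f) (x - x0) = - ip w (x - x0)" by (simp only: scale)
  also have "ip w (x - x0) = ip ((k - k0) + \<delta>) w"
    unfolding comm[of w] x x0 \<delta>_def by (simp add: algebra_simps)
  also have "\<dots> = ip (k - k0) w + ip w \<delta>" by (simp only: add comm[of \<delta>])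
  finally have 1: "m * (norm (x - x0))\<^sup>2 \<le> - (c * (norm w)\<^sup>2) - ip w \<delta>"
    using N K by (simp add: w_def)
  \<comment> \<open>Completing the square.\<close>
  have "0 \<le> (norm ((2 * c) *\<^sub>R w + \<delta>))\<^sup>2" by simp
  also have "\<dots> = 4 * c * (c * (norm w)\<^sup>2 + ip w \<delta>) + (norm \<delta>)\<^sup>2"
    unfolding hilbert_inner_norm_add[OF ip] scale using c
    by (simp add: power_mult_distrib power2_eq_square algebra_simps)
  finally have "- (c * (norm w)\<^sup>2) - ip w \<delta> \<le> (norm \<delta>)\<^sup>2 / (4 * c)"
    using c by (simp add: field_simps)
  with 1 show ?thesis by (simp add: \<delta>_def)
qed

lemma strongly_monotone_solutions_tendsto:
  fixes ip :: "'x::banach \<Rightarrow> 'x \<Rightarrow> real"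
  assumes ip: "hilbert_inner ip" and K: "class_M ip (K \<circ> riesz ip)"
    and N: "class_M ip (\<lambda>x. - (inv (riesz ip) \<circ> N) x)"
    and x0: "x0 = K (N x0) + h0" and x: "\<And>n. x n = K (N (x n)) + h n"
    and h: "h \<longlonglongrightarrow> h0"
  shows "x \<longlonglongrightarrow> x0"
proof -
  define N' where "N' = inv (riesz ip) \<circ> N"
  have N': "riesz ip (N' y) = N y" for y
    using riesz_surj[OF ip] by (simp add: N'_def surj_f_inv_f)
  obtain c where c: "c > 0" and Kc: "\<And>a b. c * (norm (a - b))\<^sup>2 \<le> ip (K (riesz ip a) - K (riesz ip b)) (a - b)"
    using K by (auto simp: class_M_def)
  obtain m where m: "m > 0" and Nm: "\<And>y z. m * (norm (y - z))\<^sup>2 \<le> ip (- N' y - - N' z) (y - z)"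
    using N by (auto simp: class_M_def N'_def)
  have bound: "norm (x n - x0) \<le> sqrt ((norm (h n - h0))\<^sup>2 / (4 * c) / m)" for n
  proof -
    have "m * (norm (x n - x0))\<^sup>2 \<le> (norm (h n - h0))\<^sup>2 / (4 * c)"
      using strongly_monotone_perturbation_estimate[OF ip c _ _ x x0, of "N' (x n)" "N' x0" n m]
        Kc[of "N' (x n)" "N' x0"] Nm[of "x n" x0] by (simp add: N')
    then have "(norm (x n - x0))\<^sup>2 \<le> (norm (h n - h0))\<^sup>2 / (4 * c) / m"
      unfolding pos_le_divide_eq[OF m] by (simp only: mult.commute)
    then show ?thesis by (rule real_le_rsqrt)
  qed
  have \<delta>: "(\<lambda>n. h n - h0) \<longlonglongrightarrow> 0" using h by (rule LIM_zero)
  have "(\<lambda>n. x n - x0) \<longlonglongrightarrow> 0"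
  proof (rule Lim_null_comparison)
    show "\<forall>\<^sub>F n in sequentially. norm (x n - x0) \<le> sqrt ((norm (h n - h0))\<^sup>2 / (4 * c) / m)"
      using bound by simp
    show "(\<lambda>n. sqrt ((norm (h n - h0))\<^sup>2 / (4 * c) / m)) \<longlonglongrightarrow> 0"
      using c m by (auto intro!: tendsto_eq_intros h)
  qed
  then show ?thesis by (simp add: LIM_zero_iff)
qed

section \<open>Existence of an optimal pair\<close>
text \<open>Complete continuity of \<open>H\<close> turns weak convergence of controls into norm convergence of the
  inhomogeneities, to which the continuous dependence results apply.\<close>

lemma completely_continuous_solution_operator:
  fixes K :: "('x::banach \<Rightarrow>\<^sub>L real) \<Rightarrow> 'x"
  assumes T: "\<And>u. u \<in> U \<Longrightarrow> T u = K (N (T u)) + H u"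
    and cond: "conditions_A U K N H \<or> conditions_B U K N H"
  shows "completely_continuous_on U T"
  unfolding completely_continuous_on_def
proof (intro allI impI)
  fix u l assume u: "(\<forall>n :: nat. u n \<in> U) \<and> l \<in> U \<and> limitin weak_topology u l sequentially"
  have x0: "T l = K (N (T l)) + H l" and x: "\<And>n. T (u n) = K (N (T (u n))) + H (u n)"
    using T u by blast+
  have "completely_continuous_on U H"
    using cond by (auto simp: conditions_A_def conditions_B_def Let_def)
  then have h: "(\<lambda>n. H (u n)) \<longlonglongrightarrow> H l"
    using u unfolding completely_continuous_on_def by blast
  from cond show "(\<lambda>n. T (u n)) \<longlonglongrightarrow> T l"
  proof
    assume "conditions_A U K N H"
    then obtain d where "linear K" "d > 0" "\<And>f. d * (norm (K f))\<^sup>2 \<le> blinfun_apply f (K f)"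
      "bounded_map N" "negatively_monotone N"
      by (auto simp: conditions_A_def)
    then show ?thesis by (rule monotone_solutions_tendsto[OF _ _ _ _ _ x0 x h])
  next
    assume "conditions_B U K N H"
    then obtain ip where ip: "hilbert_inner ip" "class_M ip (K \<circ> riesz ip)"
      and "mu ip (\<lambda>x. - (inv (riesz ip) \<circ> N) x) > 0"
      by (auto simp: conditions_B_def Let_def)
    then have "class_M ip (\<lambda>x. - (inv (riesz ip) \<circ> N) x)" by (intro mu_pos_imp_class_M)
    then show ?thesis by (rule strongly_monotone_solutions_tendsto[OF ip _ x0 x h])
  qed
qed

text \<open>Half of \<open>e\<close> pays for replacing \<open>xs n\<close> by \<open>x\<close>, uniformly in the control, and half for the weakly
  convergent affine minorant of \<open>\<phi> (\<cdot>, x)\<close> at \<open>l\<close>.\<close>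

lemma cost_weakly_lower_semicontinuous:
  fixes \<phi> :: "'z::real_normed_vector \<times> 'x::topological_space \<Rightarrow> real"
  assumes convex: "convex_on UNIV (\<lambda>u. \<phi> (u, x))" and cont: "continuous_on UNIV (\<lambda>u. \<phi> (u, x))"
    and unif: "(\<lambda>n. SUP u\<in>U. ereal \<bar>\<phi> (u, xs n) - \<phi> (u, x)\<bar>) \<longlonglongrightarrow> 0"
    and u: "\<And>n. u n \<in> U" and weak: "limitin weak_topology u l sequentially"
    and e: "e > 0"
  shows "\<forall>\<^sub>F n in sequentially. \<phi> (l, x) - e \<le> \<phi> (u n, xs n)"
proof -
  obtain f :: "'z \<Rightarrow>\<^sub>L real" where f: "\<And>v. \<phi> (l, x) + blinfun_apply f (v - l) \<le> \<phi> (v, x)"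
    using convex_subgradient[OF convex cont, of l] by blast
  have "(\<lambda>n. blinfun_apply f (u n)) \<longlonglongrightarrow> blinfun_apply f l"
    using weak by (simp add: limitin_weak_topology_iff)
  then have "\<forall>\<^sub>F n in sequentially. blinfun_apply f l - e / 2 < blinfun_apply f (u n)"
    by (rule order_tendstoD(1)) (use e in simp)
  moreover have "\<forall>\<^sub>F n in sequentially. (SUP u\<in>U. ereal \<bar>\<phi> (u, xs n) - \<phi> (u, x)\<bar>) < ereal (e / 2)"
    using unif by (rule order_tendstoD(2)) (use e in simp)
  ultimately show ?thesis
  proof eventually_elim
    case (elim n)
    have "ereal \<bar>\<phi> (u n, xs n) - \<phi> (u n, x)\<bar> < ereal (e / 2)"
      using elim(2) by (rule le_less_trans[rotated]) (rule SUP_upper[OF u])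
    then have "\<bar>\<phi> (u n, xs n) - \<phi> (u n, x)\<bar> < e / 2" by simp
    moreover have "\<phi> (l, x) + (blinfun_apply f (u n) - blinfun_apply f l) \<le> \<phi> (u n, x)"
      using f[of "u n"] by (simp add: blinfun.diff_right)
    ultimately show ?case using elim(1) by linarith
  qed
qed

theorem theorem3p3:
  fixes U :: "'z::banach set"
    and K :: "('x::banach \<Rightarrow>\<^sub>L real) \<Rightarrow> 'x"
    and N :: "'x \<Rightarrow> ('x \<Rightarrow>\<^sub>L real)"
    and H :: "'z \<Rightarrow> 'x"
    and \<phi> :: "'z \<times> 'x \<Rightarrow> real"
    and T :: "'z \<Rightarrow> 'x"
  assumes "reflexive_space TYPE('x)" and "reflexive_space TYPE('z)"
    and "U \<noteq> {}"
    and "\<forall>u\<in>U. \<exists>!x. x = K (N x) + H u"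
    and "T = solution_operator K N H"
    and "conditions_A U K N H \<or> conditions_B U K N H"
    and "\<forall>x. convex_on UNIV (\<lambda>u. \<phi> (u, x)) \<and> continuous_on UNIV (\<lambda>u. \<phi> (u, x))"
    and "\<forall>x xs. xs \<longlonglongrightarrow> x \<longrightarrow>
           (\<lambda>n. SUP u\<in>U. ereal \<bar>\<phi> (u, xs n) - \<phi> (u, x)\<bar>) \<longlonglongrightarrow> 0"
    and "compactin weak_topology U"
  shows "\<exists>us\<in>U. \<exists>xs. xs = T us \<and> ereal (\<phi> (us, xs)) = (INF u\<in>U. ereal (\<phi> (u, T u)))"
proof -
  have "T u = K (N (T u)) + H u" if "u \<in> U" for u
    using theI'[OF assms(4)[rule_format, OF that]] by (simp only: assms(5) solution_operator_def)
  then have T: "completely_continuous_on U T"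
    using assms(6) by (rule completely_continuous_solution_operator)
  define I where "I = (INF u\<in>U. ereal (\<phi> (u, T u)))"
  obtain c where c: "decseq c" "range c \<subseteq> (\<lambda>u. ereal (\<phi> (u, T u))) ` U" "I = (INF n :: nat. c n)"
    using Inf_countable_INF[of "(\<lambda>u. ereal (\<phi> (u, T u))) ` U"] assms(3) unfolding I_def by auto
  have "\<exists>u\<in>U. c n = ereal (\<phi> (u, T u))" for n using c(2) by auto
  then obtain v where v: "\<And>n. v n \<in> U" and cv: "\<And>n. c n = ereal (\<phi> (v n, T (v n)))" by metis
  obtain us r where us: "us \<in> U" and r: "strict_mono (r :: nat \<Rightarrow> nat)"
    and weak: "limitin weak_topology (v \<circ> r) us sequentially"
    using weakly_compact_imp_weakly_seq_compact[of U v, OF assms(9) v] by blast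
  have "(\<lambda>n. T ((v \<circ> r) n)) \<longlonglongrightarrow> T us"
    using T[unfolded completely_continuous_on_def, rule_format, of "v \<circ> r" us] v us weak by simp
  then have unif: "(\<lambda>n. SUP u\<in>U. ereal \<bar>\<phi> (u, T ((v \<circ> r) n)) - \<phi> (u, T us)\<bar>) \<longlonglongrightarrow> 0"
    using assms(8) by blast
  have "(\<lambda>n. ereal (\<phi> ((v \<circ> r) n, T ((v \<circ> r) n)))) \<longlonglongrightarrow> I"
    using LIMSEQ_subseq_LIMSEQ[OF LIMSEQ_INF[OF c(1)] r] by (simp add: c(3) cv comp_def)
  \<comment> \<open>The infimum is not known to be finite beforehand, hence the passage to the limit in the
    extended reals.\<close>
  have "ereal (\<phi> (us, T us)) \<le> I + ereal e" if e: "e > 0" for e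
  proof -
    have "\<forall>\<^sub>F n in sequentially. \<phi> (us, T us) - e \<le> \<phi> ((v \<circ> r) n, T ((v \<circ> r) n))"
      using cost_weakly_lower_semicontinuous[OF _ _ unif _ weak e] assms(7) v by simp
    then have "\<forall>\<^sub>F n in sequentially. ereal (\<phi> (us, T us) - e) \<le> ereal (\<phi> ((v \<circ> r) n, T ((v \<circ> r) n)))"
      by simp
    then have "ereal (\<phi> (us, T us) - e) \<le> I"
      by (rule tendsto_lowerbound[OF \<open>_ \<longlonglongrightarrow> I\<close>]) simp
    then show ?thesis by (cases I) auto
  qed
  then have "ereal (\<phi> (us, T us)) \<le> I" by (rule ereal_le_epsilon2)
  moreover have "I \<le> ereal (\<phi> (us, T us))" unfolding I_def by (rule INF_lower[OF us])
  ultimately show ?thesis using us unfolding I_def by (intro bexI[of _ us]) auto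
qed

end
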